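(* Consider the disordered pinning model with inter-arrival law $K(n)=L(n)/n^{1+\alpha}$, where $\alpha\ge0$ and $L$ is slowly varying. For every $h\in\mathbb R$, the free energy $\beta\mapsto F(\beta,h)$ is a non-increasing function of $\beta$ on $[0,\infty)$. Therefore: (i) $\beta\mapsto h_c(\beta)$ is a non-decreasing function of $\beta\in[0,\infty)$. (ii) There exists a critical value $\beta_c\in[0,\infty]$ such that, for $\beta\in[0,\infty)$, $h_c(0)=h_c(\beta)$ if and only if $\beta\le\beta_c$.
   Context: Slowly varying: $L:(0,\infty)\to(0,\infty)$ is measurable with $\lim_{x\to\infty}L(cx)/L(x)=1$ for every $c>0$. Standing assumption (no loss of generality): $L$ is smooth. Renewal process: $\tau=\{\tau_n\}_{n\ge0}$ has law $\mathbf P$ (expectation $\mathbf E$), $\tau_0=0$, and the increments $\tau_{j+1}-\tau_j$ are i.i.d. with values in $\mathbb N=\{1,2,\dots\}$ and law $K(n)=\mathbf P(\tau_1=n)=L(n)/n^{1+\alpha}$, with $\alpha\ge 0$ and $\sum_{n\ge1}K(n)=1$. View $\tau$ as a random subset of $\{0\}\cup\mathbb N$ and put $\delta_n:=\mathbf 1_{\{n\in\tau\}}$. Disorder: $\omega=\{\omega_n\}_{n\ge1}$ is an i.i.d. sequence with law $\mathbb P$ (expectation $\mathbb E$), $\mathbb E[\omega_1]=0$, $\mathrm{var}(\omega_1)=1$, and $M(t):=\mathbb E[\exp(t\omega_1)]<\infty$ for every $t\in\mathbb R$. Model: for $\beta\ge0$, $h\in\mathbb R$, $$Z_{N,\omega}:=\mathbf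 E\Big[\exp\Big(\sum_{n=1}^N(\beta\omega_n+h-\log M(\beta))\delta_n\Big)\delta_N\Big].$$ The free energy is $F(\beta,h):=\lim_{N\to\infty}\frac1N\mathbb E\log Z_{N,\omega}$ (the limit exists, is nonnegative, non-decreasing in $h$, and continuous in both arguments), and the critical point is $h_c(\beta):=\sup\{h: F(\beta,h)=0\}$. *)

theory Defs
  imports "HOL-Probability.Probability"
begin

text \<open>Functions on \<^term>\<open>{0<..} :: real set\<close> are total functions whose values outside that
  interval are irrelevant.\<close>

definition slowly_varying :: "(real \<Rightarrow> real) \<Rightarrow> bool" where
  "slowly_varying L \<longleftrightarrow>
     (\<forall>x>0. L x > 0) \<and>
     L \<in> borel_measurable (restrict_space borel {0<..}) \<and>
     (\<forall>c>0. ((\<lambda>x. L (c * x) / L x) \<longlongrightarrow> 1) at_top)"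

definition smooth_on_pos :: "(real \<Rightarrow> real) \<Rightarrow> bool" where
  "smooth_on_pos L \<longleftrightarrow> (\<forall>k::nat. \<forall>x>0. ((deriv ^^ k) L) field_differentiable (at x))"

definition inter_arrival :: "(real \<Rightarrow> real) \<Rightarrow> real \<Rightarrow> nat \<Rightarrow> real" where
  "inter_arrival L \<alpha> n = L (real n) / real n powr (1 + \<alpha>)"

text \<open>Strict monotonicity says that the increments lie in \<open>{1, 2, \<dots>}\<close>; in particular the
  subtraction on the naturals below is never truncated.\<close>

locale renewal_process = prob_space P
  for P :: "'a measure" and \<tau> :: "nat \<Rightarrow> 'a \<Rightarrow> nat" and K :: "nat \<Rightarrow> real" +
  assumes tau_zero: "\<And>x. x \<in> space P \<Longrightarrow> \<tau> 0 x = 0"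
    and tau_strict: "\<And>j x. x \<in> space P \<Longrightarrow> \<tau> j x < \<tau> (Suc j) x"
    and increments_indep:
      "indep_vars (\<lambda>_. count_space UNIV) (\<lambda>j x. \<tau> (Suc j) x - \<tau> j x) UNIV"
    and increments_law:
      "\<And>j n. n \<ge> 1 \<Longrightarrow> prob {x \<in> space P. \<tau> (Suc j) x - \<tau> j x = n} = K n"

definition mgf :: "'b measure \<Rightarrow> (nat \<Rightarrow> 'b \<Rightarrow> real) \<Rightarrow> real \<Rightarrow> real" where
  "mgf Q \<omega> t = (\<integral>y. exp (t * \<omega> 1 y) \<partial>Q)"

text \<open>The disorder variables are those of index at least 1; \<open>\<omega> 0\<close> is unconstrained and unused.\<close>

locale disorder = prob_space Q
  for Q :: "'b measure" and \<omega> :: "nat \<Rightarrow> 'b \<Rightarrow> real" +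
  assumes omega_indep: "indep_vars (\<lambda>_. borel) \<omega> {1..}"
    and omega_ident: "\<And>n. n \<ge> 1 \<Longrightarrow> distr Q borel (\<omega> n) = distr Q borel (\<omega> 1)"
    and omega_exp_moments: "\<And>t. integrable Q (\<lambda>y. exp (t * \<omega> 1 y))"
    and omega_mean: "expectation (\<omega> 1) = 0"
    and omega_var: "variance (\<omega> 1) = 1"

locale pinning_model =
  renewal: renewal_process P \<tau> "inter_arrival L \<alpha>" + disorder: disorder Q \<omega>
  for P :: "'a measure" and \<tau> :: "nat \<Rightarrow> 'a \<Rightarrow> nat"
    and Q :: "'b measure" and \<omega> :: "nat \<Rightarrow> 'b \<Rightarrow> real"
    and L :: "real \<Rightarrow> real" and \<alpha> :: real +
  assumes alpha_nonneg: "\<alpha> \<ge> 0"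
    and L_slowly_varying: "slowly_varying L"
    and L_smooth: "smooth_on_pos L"
    and law_sums: "(\<lambda>n. inter_arrival L \<alpha> (Suc n)) sums 1"

definition contact :: "(nat \<Rightarrow> 'a \<Rightarrow> nat) \<Rightarrow> nat \<Rightarrow> 'a \<Rightarrow> real" where
  "contact \<tau> n x = indicator (range (\<lambda>j. \<tau> j x)) n"

text \<open>The argument \<open>y\<close> is the sample point of the disorder, so that \<open>\<lambda>y. partition_fn P \<tau> Q \<omega> \<beta> h N y\<close>
  is the random variable \<open>Z\<close> on \<open>Q\<close>; the integral is over the renewal process only.\<close>

definition partition_fn ::
  "'a measure \<Rightarrow> (nat \<Rightarrow> 'a \<Rightarrow> nat) \<Rightarrow> 'b measure \<Rightarrow> (nat \<Rightarrow> 'b \<Rightarrow> real) \<Rightarrow>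
   real \<Rightarrow> real \<Rightarrow> nat \<Rightarrow> 'b \<Rightarrow> real" where
  "partition_fn P \<tau> Q \<omega> \<beta> h N y =
     (\<integral>x. exp (\<Sum>n=1..N. (\<beta> * \<omega> n y + h - ln (mgf Q \<omega> \<beta>)) * contact \<tau> n x) * contact \<tau> N x \<partial>P)"

definition free_energy ::
  "'a measure \<Rightarrow> (nat \<Rightarrow> 'a \<Rightarrow> nat) \<Rightarrow> 'b measure \<Rightarrow> (nat \<Rightarrow> 'b \<Rightarrow> real) \<Rightarrow>
   real \<Rightarrow> real \<Rightarrow> real" where
  "free_energy P \<tau> Q \<omega> \<beta> h =
     lim (\<lambda>N. 1 / real N * (\<integral>y. ln (partition_fn P \<tau> Q \<omega> \<beta> h N y) \<partial>Q))"

definition critical_point ::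
  "'a measure \<Rightarrow> (nat \<Rightarrow> 'a \<Rightarrow> nat) \<Rightarrow> 'b measure \<Rightarrow> (nat \<Rightarrow> 'b \<Rightarrow> real) \<Rightarrow> real \<Rightarrow> real" where
  "critical_point P \<tau> Q \<omega> \<beta> = Sup {h. free_energy P \<tau> Q \<omega> \<beta> h = 0}"

end

theory Submission
  imports Defs "HOL-Real_Asymp.Real_Asymp"
begin

text \<open>Decomposing according to the last jump, the partition function is the solution of
  \<open>Z 0 = 1\<close>, \<open>Z N = w N * (\<Sum>m<N. K (N - m) * Z m)\<close> with site weights
  \<open>w n = exp (\<beta> \<omega>\<^sub>n + h - ln M(\<beta>))\<close>. It is supermultiplicative, so \<open>F\<close> exists as a
  limit and a supremum, and it is affine in every single weight.

  For \<open>\<beta> < \<beta>'\<close> the two weights of a site are increasing in \<open>\<omega>\<^sub>n\<close>, have the same mean and cross exactly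
  once. Hence the weight at \<open>\<beta>'\<close> dominates the one at \<open>\<beta>\<close> in the convex order, and replacing the weights
  one site at a time decreases \<open>E ln Z\<close>, because \<open>ln (a + b x)\<close> is concave. This gives the
  monotonicity of \<open>F\<close> and of the critical point.

  Monotonicity leaves open whether the set of \<open>\<beta>\<close> with \<open>h\<^sub>c(\<beta>) = h\<^sub>c(0)\<close> is closed. By Jensen's inequality
  \<open>Z(w\<^sup>s) \<le> Z(w)\<^sup>s\<close> for \<open>s \<le> 1\<close>, so \<open>F(\<beta>, h) = 0\<close> implies \<open>F(s \<beta>, s (h - ln M(\<beta>)) + ln M(s \<beta>)) = 0\<close>;
  letting \<open>s\<close> tend to 1 shows that \<open>h\<^sub>c\<close> is left-continuous on \<open>(0, \<infinity>)\<close>.\<close>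

section \<open>Pinned partition functions with deterministic weights\<close>

function pinned :: "(nat \<Rightarrow> real) \<Rightarrow> (nat \<Rightarrow> real) \<Rightarrow> nat \<Rightarrow> real" where
  "pinned K w N = (if N = 0 then 1 else w N * (\<Sum>m<N. K (N - m) * pinned K w m))"
  by auto
termination by (relation "Wellfounded.measure (\<lambda>(K, w, N). N)") auto

declare pinned.simps [simp del]

lemma pinned_0 [simp]: "pinned K w 0 = 1"
  by (simp add: pinned.simps)

lemma pinned_pos_eq:
  "0 < N \<Longrightarrow> pinned K w N = w N * (\<Sum>m<N. K (N - m) * pinned K w m)"
  by (subst pinned.simps) simp

lemma pinned_cong:
  assumes "\<And>n. 1 \<le> n \<Longrightarrow> n \<le> N \<Longrightarrow> w n = v n"
  shows "pinned K w N = pinned K v N"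
  using assms
proof (induction N rule: less_induct)
  case (less N)
  show ?case
  proof (cases "N = 0")
    case False
    have "(\<Sum>m<N. K (N - m) * pinned K w m) = (\<Sum>m<N. K (N - m) * pinned K v m)"
      using less by (intro sum.cong) auto
    with False less.prems[of N] show ?thesis
      by (simp add: pinned_pos_eq)
  qed simp
qed

lemma pinned_measurable:
  assumes "\<And>n. 1 \<le> n \<Longrightarrow> n \<le> N \<Longrightarrow> (\<lambda>x. W x n) \<in> borel_measurable M"
  shows "(\<lambda>x. pinned K (W x) N) \<in> borel_measurable M"
  using assms
proof (induction N rule: less_induct)
  case (less N)
  show ?case
  proof (cases "N = 0")
    case False
    then show ?thesis using less
      by (auto simp: pinned_pos_eq intro!: borel_measurable_times borel_measurable_sum)
  qed simp
qed

text \<open>A path visits site \<open>i\<close> at most once, so the weight of that site enters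
  every path contribution at most to the first power.\<close>

lemma pinned_affine:
  "pinned K (w(i := x)) N =
     pinned K (w(i := 0)) N + x * (pinned K (w(i := 1)) N - pinned K (w(i := 0)) N)"
proof (induction N rule: less_induct)
  case (less N)
  consider "N = 0" | "0 < N" "N < i" | "0 < N" "N = i" | "0 < N" "i < N" by linarith
  then show ?case
  proof cases
    case 2
    then have eq: "pinned K (w(i := z)) N = pinned K w N" for z
      by (intro pinned_cong) auto
    show ?thesis unfolding eq by simp
  next
    case 3
    then have "pinned K (w(i := z)) m = pinned K w m" if "m < N" for z m
      using that by (intro pinned_cong) auto
    then have eq: "pinned K (w(i := z)) N = z * (\<Sum>m<N. K (N - m) * pinned K w m)" for z
      using 3 by (simp add: pinned_pos_eq)
    show ?thesis unfolding eq by simp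
  next
    case 4
    let ?S = "\<lambda>z. \<Sum>m<N. K (N - m) * pinned K (w(i := z)) m"
    have eq: "pinned K (w(i := z)) N = w N * ?S z" for z
      using 4 by (simp add: pinned_pos_eq)
    have "?S x = (\<Sum>m<N. K (N - m) * (pinned K (w(i := 0)) m
                 + x * (pinned K (w(i := 1)) m - pinned K (w(i := 0)) m)))"
      by (intro sum.cong refl, subst less.IH[symmetric]) auto
    also have "\<dots> = ?S 0 + x * (?S 1 - ?S 0)"
      by (simp add: algebra_simps sum.distrib sum_subtractf sum_distrib_left)
    finally have S: "?S x = ?S 0 + x * (?S 1 - ?S 0)" .
    show ?thesis unfolding eq S by (simp add: algebra_simps)
  qed simp
qed

text \<open>Each \<open>x i powr s\<close> lies below the tangent of \<open>u \<mapsto> u powr s\<close> at \<open>\<Sum>i\<in>I. p i * x i\<close>. The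
  intercept of that tangent is nonnegative, so total mass at most 1 suffices.\<close>

lemma sum_powr_le_powr_sum:
  fixes p x :: "'i \<Rightarrow> real"
  assumes "finite I" "\<And>i. i \<in> I \<Longrightarrow> 0 \<le> p i" "\<And>i. i \<in> I \<Longrightarrow> 0 < x i" "sum p I \<le> 1"
    and s: "0 < s" "s \<le> 1"
  shows "(\<Sum>i\<in>I. p i * x i powr s) \<le> (\<Sum>i\<in>I. p i * x i) powr s"
proof (cases "(\<Sum>i\<in>I. p i * x i) = 0")
  case True
  then have "\<forall>i\<in>I. p i * x i = 0"
    using assms by (subst (asm) sum_nonneg_eq_0_iff) (auto intro: less_imp_le mult_nonneg_nonneg)
  then have "p i = 0" if "i \<in> I" for i using assms(3)[OF that] that by fastforce
  then show ?thesis by simp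
next
  case False
  define c where "c = (\<Sum>i\<in>I. p i * x i)"
  have "c \<ge> 0" unfolding c_def using assms by (auto intro!: sum_nonneg mult_nonneg_nonneg intro: less_imp_le)
  with False have c: "c > 0" by (simp add: c_def)
  have tangent: "x i powr s \<le> c powr s * (s * (x i / c) + (1 - s))" if "i \<in> I" for i
  proof -
    have "(x i / c) powr s * 1 powr (1 - s) \<le> s * (x i / c) + (1 - s) * 1"
      using s c assms(3)[OF that] by (intro Youngs_inequality_0) auto
    then have "c powr s * (x i / c) powr s \<le> c powr s * (s * (x i / c) + (1 - s))"
      by (intro mult_left_mono) auto
    moreover have "c powr s * (x i / c) powr s = x i powr s"
      using c assms(3)[OF that] by (simp add: powr_divide)
    ultimately show ?thesis by simp
  qed
  have "(\<Sum>i\<in>I. p i * x i powr s) \<le> (\<Sum>i\<in>I. p i * (c powr s * (s * (x i / c) + (1 - s))))"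
    using assms(2) tangent by (intro sum_mono mult_left_mono)
  also have "\<dots> = c powr s * (s * ((\<Sum>i\<in>I. p i * x i) / c) + (1 - s) * sum p I)"
    by (simp add: sum_distrib_left sum.distrib sum_distrib_right algebra_simps sum_divide_distrib sum_subtractf)
  also have "\<dots> = c powr s * (s + (1 - s) * sum p I)"
    using c by (simp add: c_def[symmetric])
  also have "\<dots> \<le> c powr s * (s + (1 - s) * 1)"
    using assms by (intro mult_left_mono add_left_mono) auto
  finally show ?thesis by (simp add: c_def)
qed

text \<open>The sum is \<open>K 1 + ... + K N\<close>, written in the order in which the recursion
  for \<open>pinned\<close> meets it.\<close>

locale renewal_kernel =
  fixes K :: "nat \<Rightarrow> real"
  assumes K_pos: "n \<ge> 1 \<Longrightarrow> K n > 0"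
    and K_sum_le_1: "(\<Sum>m<N. K (N - m)) \<le> 1"
begin

lemma K_diff_nonneg: "m < N \<Longrightarrow> 0 \<le> K (N - m)"
  using K_pos[of "N - m"] by (simp add: less_imp_le)

lemma pinned_nonneg:
  assumes "\<And>n. w n \<ge> 0" shows "pinned K w N \<ge> 0"
proof (induction N rule: less_induct)
  case (less N)
  then show ?case
    by (cases "N = 0")
       (auto simp: pinned_pos_eq intro!: mult_nonneg_nonneg sum_nonneg assms K_diff_nonneg)
qed

text \<open>Keeps only the term \<open>m = 0\<close>, the path that jumps from 0 to \<open>N\<close>
  at once.\<close>

lemma pinned_ge_one_jump:
  assumes "\<And>n. w n \<ge> 0" "0 < N" shows "pinned K w N \<ge> w N * K N"
proof -
  have "K (N - 0) * pinned K w 0 \<le> (\<Sum>m<N. K (N - m) * pinned K w m)"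
    using assms by (intro member_le_sum) (auto intro!: mult_nonneg_nonneg pinned_nonneg K_diff_nonneg)
  then show ?thesis
    using assms by (simp add: pinned_pos_eq mult_left_mono)
qed

lemma pinned_pos:
  assumes "\<And>n. w n > 0" shows "pinned K w N > 0"
proof (cases "N = 0")
  case False
  have "0 < w N * K N" using assms K_pos False by simp
  also have "\<dots> \<le> pinned K w N"
    using assms False by (intro pinned_ge_one_jump) (auto intro: less_imp_le)
  finally show ?thesis .
qed simp

lemma pinned_mono:
  assumes "\<And>n. 0 \<le> w n" "\<And>n. w n \<le> v n" shows "pinned K w N \<le> pinned K v N"
proof (induction N rule: less_induct)
  case (less N)
  show ?case
  proof (cases "N = 0")
    case False
    have "0 \<le> v n" for n using assms order_trans by blast
    then show ?thesis using False less
      by (auto simp: pinned_pos_eq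
          intro!: mult_mono sum_mono mult_left_mono assms sum_nonneg mult_nonneg_nonneg
                  K_diff_nonneg pinned_nonneg)
  qed simp
qed

text \<open>Since \<open>1 \<le> v n\<close>, the partial products of \<open>v\<close> are
  non-decreasing, so all earlier values are bounded by the product up to \<open>N - 1\<close>.
  Summing against kernel mass at most 1 preserves that bound.\<close>

lemma pinned_le_prod:
  assumes "\<And>n. 0 \<le> w n" "\<And>n. w n \<le> v n" "\<And>n. 1 \<le> v n"
  shows "pinned K w N \<le> (\<Prod>n=1..N. v n)"
proof (induction N rule: less_induct)
  case (less N)
  show ?case
  proof (cases "N = 0")
    case False
    then obtain M where N: "N = Suc M" using not0_implies_Suc by blast
    let ?p = "\<lambda>N. \<Prod>n=1..N. v n"
    have v0: "0 \<le> v n" for n using assms(3)[of n] by simp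
    have p: "?p m \<le> ?p M" if "m \<le> M" for m
      using that assms(3) v0 by (intro prod_mono2) (auto intro: order_trans[OF zero_le_one])
    have "(\<Sum>m<N. K (N - m) * pinned K w m) \<le> (\<Sum>m<N. K (N - m) * ?p M)"
      using less.IH p N
      by (intro sum_mono mult_left_mono K_diff_nonneg) (meson lessThan_iff less_Suc_eq_le order_trans, simp)
    also have "\<dots> = (\<Sum>m<N. K (N - m)) * ?p M" by (simp add: sum_distrib_right)
    also have "\<dots> \<le> 1 * ?p M"
      by (intro mult_right_mono K_sum_le_1 prod_nonneg) (auto intro: v0)
    finally have "pinned K w N \<le> v N * (1 * ?p M)"
      using False assms v0
      by (subst pinned_pos_eq)
         (auto intro!: mult_mono sum_nonneg mult_nonneg_nonneg K_diff_nonneg pinned_nonneg)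
    then show ?thesis by (simp add: N mult.commute)
  qed simp
qed

text \<open>Paths to \<open>N + M\<close> that visit \<open>N\<close> factorise there, and dropping
  all other paths only loses nonnegative terms.\<close>

lemma pinned_supermultiplicative:
  assumes "\<And>n. 0 \<le> w n"
  shows "pinned K w N * pinned K (\<lambda>n. w (N + n)) M \<le> pinned K w (N + M)"
proof (induction M rule: less_induct)
  case (less M)
  show ?case
  proof (cases "M = 0")
    case False
    let ?g = "\<lambda>m. K (N + M - m) * pinned K w m"
    have "pinned K w N * (\<Sum>m<M. K (M - m) * pinned K (\<lambda>n. w (N + n)) m)
        = (\<Sum>m<M. K (M - m) * (pinned K w N * pinned K (\<lambda>n. w (N + n)) m))"
      by (simp add: sum_distrib_left mult_ac)
    also have "\<dots> \<le> (\<Sum>m<M. ?g (N + m))"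
      using less.IH by (auto intro!: sum_mono mult_left_mono K_diff_nonneg)
    also have "\<dots> = sum ?g ((+) N ` {..<M})"
      by (subst sum.reindex) auto
    \<comment> \<open>Last jumps that start before \<open>N\<close> are added back.\<close>
    also have "\<dots> \<le> sum ?g {..<N + M}"
      using assms by (intro sum_mono2) (auto intro!: mult_nonneg_nonneg K_diff_nonneg pinned_nonneg)
    finally have "w (N + M) * (pinned K w N * (\<Sum>m<M. K (M - m) * pinned K (\<lambda>n. w (N + n)) m))
        \<le> w (N + M) * sum ?g {..<N + M}"
      using assms by (intro mult_left_mono)
    then show ?thesis using False by (simp add: pinned_pos_eq mult_ac)
  qed simp
qed

text \<open>Jensen's inequality is applied to each sum over the last jump, with the sub-probability
  weights \<open>K (N - m)\<close>.\<close>

lemma pinned_powr_le: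
  assumes "\<And>n. 0 < w n" "0 < s" "s \<le> 1"
  shows "pinned K (\<lambda>n. w n powr s) N \<le> pinned K w N powr s"
proof (induction N rule: less_induct)
  case (less N)
  show ?case
  proof (cases "N = 0")
    case False
    have "(\<Sum>m<N. K (N - m) * pinned K (\<lambda>n. w n powr s) m)
        \<le> (\<Sum>m<N. K (N - m) * pinned K w m powr s)"
      using less by (intro sum_mono mult_left_mono K_diff_nonneg) auto
    also have "\<dots> \<le> (\<Sum>m<N. K (N - m) * pinned K w m) powr s"
      using assms by (intro sum_powr_le_powr_sum K_sum_le_1 pinned_pos) (auto intro: K_diff_nonneg)
    finally have "w N powr s * (\<Sum>m<N. K (N - m) * pinned K (\<lambda>n. w n powr s) m)
        \<le> w N powr s * (\<Sum>m<N. K (N - m) * pinned K w m) powr s"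
      by (intro mult_left_mono) auto
    also have "\<dots> = (w N * (\<Sum>m<N. K (N - m) * pinned K w m)) powr s"
      using assms(1)
      by (intro powr_mult[symmetric]) 
    finally show ?thesis using False by (simp add: pinned_pos_eq)
  qed simp
qed

end

section \<open>Integrability of the logarithm of the partition function\<close>

context renewal_kernel
begin

lemma ln_pinned_ge:
  assumes "0 < N" shows "a N + ln (K N) \<le> ln (pinned K (\<lambda>n. exp (a n)) N)"
proof -
  have "a N + ln (K N) = ln (exp (a N) * K N)"
    using K_pos[of N] assms by (subst ln_mult) auto
  also have "\<dots> \<le> ln (pinned K (\<lambda>n. exp (a n)) N)"
    using assms K_pos[of N] pinned_ge_one_jump[of "\<lambda>n. exp (a n)" N]
    by (intro ln_mono) auto
  finally show ?thesis .
qed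

lemma ln_pinned_le: "ln (pinned K (\<lambda>n. exp (a n)) N) \<le> (\<Sum>n=1..N. \<bar>a n\<bar>)"
proof -
  have "pinned K (\<lambda>n. exp (a n)) N \<le> exp (\<Sum>n=1..N. \<bar>a n\<bar>)"
    unfolding exp_sum[OF finite_atLeastAtMost] by (intro pinned_le_prod) auto
  then have "ln (pinned K (\<lambda>n. exp (a n)) N) \<le> ln (exp (\<Sum>n=1..N. \<bar>a n\<bar>))"
    by (intro ln_mono pinned_pos) auto
  then show ?thesis by simp
qed

text \<open>The logarithm lies between the energy of the last site plus \<open>ln (K N)\<close> and
  the sum of all absolute energies, and both bounds are integrable.\<close>

lemma integrable_ln_pinned:
  assumes "finite_measure M" and "\<And>n. n \<ge> 1 \<Longrightarrow> integrable M (a n)"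
  shows "integrable M (\<lambda>y. ln (pinned K (\<lambda>n. exp (a n y)) N))"
proof (cases "N = 0")
  case False
  have int: "integrable M (\<lambda>y. (\<Sum>n=1..N. \<bar>a n y\<bar>) + \<bar>a N y + ln (K N)\<bar>)"
    using assms False
    by (intro Bochner_Integration.integrable_add Bochner_Integration.integrable_sum integrable_abs
        finite_measure.integrable_const) auto
  have "a n \<in> borel_measurable M" if "n \<ge> 1" for n
    using assms(2)[OF that] by simp
  then have meas: "(\<lambda>y. ln (pinned K (\<lambda>n. exp (a n y)) N)) \<in> borel_measurable M"
    by (intro borel_measurable_ln pinned_measurable) auto
  from int meas show ?thesis
  proof (rule Bochner_Integration.integrable_bound)
    have "\<bar>ln (pinned K (\<lambda>n. exp (a n y)) N)\<bar> \<le> (\<Sum>n=1..N. \<bar>a n y\<bar>) + \<bar>a N y + ln (K N)\<bar>" for y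
    proof -
      have "0 \<le> (\<Sum>n=1..N. \<bar>a n y\<bar>)" by (intro sum_nonneg) simp
      then show ?thesis
        using ln_pinned_ge[of N "\<lambda>n. a n y"] ln_pinned_le[of "\<lambda>n. a n y" N] False by linarith
    qed
    then show "AE y in M. norm (ln (pinned K (\<lambda>n. exp (a n y)) N))
        \<le> norm ((\<Sum>n=1..N. \<bar>a n y\<bar>) + \<bar>a N y + ln (K N)\<bar>)"
      by (intro AE_I2) (smt (verit) real_norm_def)
  qed
qed simp

end

section \<open>Superadditive sequences\<close>

lemma superadditive_mult_le:
  fixes a :: "nat \<Rightarrow> real"
  assumes "\<And>m n. a m + a n \<le> a (m + n)"
  shows "real q * a m + a r \<le> a (q * m + r)"
proof (induction q)
  case (Suc q)
  have "real (Suc q) * a m + a r = a m + (real q * a m + a r)" by (simp add: algebra_simps)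
  also have "\<dots> \<le> a m + a (q * m + r)" using Suc by simp
  also have "\<dots> \<le> a (m + (q * m + r))" by (rule assms)
  finally show ?case by (simp add: add.assoc)
qed simp

text \<open>Fekete's lemma; the linear bound makes the supremum finite. That the limit dominates
  every term is recorded too, so that it can be bounded below along a subsequence.\<close>

lemma fekete_superadditive:
  fixes a :: "nat \<Rightarrow> real"
  assumes super: "\<And>m n. a m + a n \<le> a (m + n)" and bound: "\<And>n. a n \<le> C * real n"
  shows "\<exists>l. (\<lambda>n. a n / real n) \<longlonglongrightarrow> l \<and> (\<forall>n\<ge>1. a n / real n \<le> l)"
proof -
  define l where "l = (SUP n\<in>{1..}. a n / real n)"
  have bdd: "bdd_above ((\<lambda>n. a n / real n) ` {1..})"
    using bound by (intro bdd_aboveI[of _ C]) (auto simp: divide_simps)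
  have le: "a n / real n \<le> l" if "n \<ge> 1" for n
    unfolding l_def using that bdd by (intro cSUP_upper) auto
  have "(\<lambda>n. a n / real n) \<longlonglongrightarrow> l"
  proof (rule order_tendstoI)
    fix u assume "l < u"
    then show "\<forall>\<^sub>F n in sequentially. a n / real n < u"
      using le by (intro eventually_sequentiallyI[of 1]) (meson order_le_less_trans)
  next
    fix u assume "u < l"
    then obtain m where m: "m \<ge> 1" "u < a m / real m"
      unfolding l_def using bdd by (subst (asm) less_cSUP_iff) auto
    define b where "b = Min (a ` {..<m})"
    define d where "d = a m / real m"
    \<comment> \<open>With \<open>n = q * m + r\<close>, superadditivity gives
      \<open>a n \<ge> d * (n - r) + a r\<close>. Replacing \<open>r\<close> by \<open>m\<close>
      costs at most \<open>\<bar>d\<bar> * m\<close>, whatever the sign of \<open>d\<close>, and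
      \<open>a r\<close> is at least \<open>b\<close>.\<close>
    have lower: "d * (real n - real m) - \<bar>b\<bar> - \<bar>d\<bar> * real m \<le> a n" for n
    proof -
      have "b \<le> a (n mod m)" unfolding b_def using m by (intro Min_le) auto
      moreover have "real (n div m) * a m + a (n mod m) \<le> a n"
        using superadditive_mult_le[of a "n div m" m "n mod m", OF super] by simp
      moreover have "real (n div m) * a m = d * (real n - real (n mod m))"
      proof -
        have "real n = real (n div m) * real m + real (n mod m)"
          by (metis div_mult_mod_eq of_nat_add of_nat_mult)
        then show ?thesis using m by (simp add: d_def)
      qed
      moreover have "d * (real m - real (n mod m)) \<ge> - (\<bar>d\<bar> * real m)"
      proof -
        have "\<bar>d * (real m - real (n mod m))\<bar> \<le> \<bar>d\<bar> * real m"
          unfolding abs_mult using m by (intro mult_left_mono) (auto simp: less_imp_le)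
        then show ?thesis by linarith
      qed
      ultimately show ?thesis by (simp add: algebra_simps)
    qed
    have "(\<lambda>n. (d * (real n - real m) - \<bar>b\<bar> - \<bar>d\<bar> * real m) / real n) \<longlonglongrightarrow> d"
      by real_asymp
    then have "\<forall>\<^sub>F n in sequentially. u < (d * (real n - real m) - \<bar>b\<bar> - \<bar>d\<bar> * real m) / real n"
      using m(2) by (auto simp: d_def[symmetric] dest: order_tendstoD)
    then show "\<forall>\<^sub>F n in sequentially. u < a n / real n"
    proof eventually_elim
      case (elim n)
      then show ?case
        using divide_right_mono[OF lower, of "real n" n] by linarith
    qed
  qed
  with le show ?thesis by blast
qed

section \<open>Path decomposition of the renewal process\<close>

context renewal_process
begin

definition incr :: "nat \<Rightarrow> 'a \<Rightarrow> nat" where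
  "incr j x = \<tau> (Suc j) x - \<tau> j x"

lemma \<tau>_eq_sum: "x \<in> space P \<Longrightarrow> \<tau> k x = (\<Sum>j<k. incr j x)"
proof (induction k)
  case (Suc k)
  then show ?case using tau_strict[of x k] by (simp add: incr_def)
qed (simp add: tau_zero)

lemma \<tau>_mono: "x \<in> space P \<Longrightarrow> i < j \<Longrightarrow> \<tau> i x < \<tau> j x"
  by (rule lift_Suc_mono_less) (use tau_strict in auto)

lemma \<tau>_le_iff: "x \<in> space P \<Longrightarrow> \<tau> i x \<le> \<tau> j x \<longleftrightarrow> i \<le> j"
  by (metis \<tau>_mono leD le_less_linear nat_less_le order_le_less)

lemma \<tau>_inj: "x \<in> space P \<Longrightarrow> \<tau> i x = \<tau> j x \<longleftrightarrow> i = j"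
  using \<tau>_le_iff by (metis order_antisym order_refl)

lemma \<tau>_ge: "x \<in> space P \<Longrightarrow> k \<le> \<tau> k x"
proof (induction k)
  case (Suc k)
  then show ?case using tau_strict[of x k] by simp
qed simp

lemma incr_measurable [measurable]: "incr j \<in> measurable P (count_space UNIV)"
  using increments_indep unfolding indep_vars_def incr_def[abs_def] by auto

lemma \<tau>_measurable [measurable]: "\<tau> k \<in> measurable P (count_space UNIV)"
  by (subst measurable_cong[OF \<tau>_eq_sum]) simp_all

text \<open>Contribution of the paths whose \<open>k\<close>-th renewal is \<open>N\<close>. The
  product starts at \<open>\<tau> 1\<close>, because the origin carries no weight.\<close>

definition path_weight :: "(nat \<Rightarrow> real) \<Rightarrow> nat \<Rightarrow> nat \<Rightarrow> 'a \<Rightarrow> real" where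
  "path_weight w k N x = of_bool (\<tau> k x = N) * (\<Prod>j<k. w (\<tau> (Suc j) x))"

lemma path_weight_measurable [measurable]: "path_weight w k N \<in> borel_measurable P"
  unfolding path_weight_def[abs_def] by measurable

lemma path_weight_bounded:
  assumes "\<And>n. 0 \<le> w n" "x \<in> space P"
  shows "\<bar>path_weight w k N x\<bar> \<le> (\<Sum>n\<le>N. w n) ^ k"
proof (cases "\<tau> k x = N")
  case True
  have "w (\<tau> (Suc j) x) \<le> (\<Sum>n\<le>N. w n)" if "j < k" for j
    using True that assms \<tau>_le_iff[OF assms(2), of "Suc j" k] by (intro member_le_sum) auto
  then have "(\<Prod>j<k. w (\<tau> (Suc j) x)) \<le> (\<Prod>j<k. \<Sum>n\<le>N. w n)"
    using assms by (intro prod_mono) auto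
  then show ?thesis using True assms
    by (simp add: path_weight_def abs_prod)
qed (simp add: path_weight_def assms sum_nonneg)

lemma path_weight_integrable:
  assumes "\<And>n. 0 \<le> w n" shows "integrable P (path_weight w k N)"
  using path_weight_bounded[OF assms]
  by (intro integrable_const_bound[of _ "(\<Sum>n\<le>N. w n) ^ k"]) auto

lemma expectation_path_weight_0:
  "expectation (path_weight w 0 N) = of_bool (N = 0)"
proof -
  have "expectation (path_weight w 0 N) = expectation (\<lambda>x. of_bool (N = 0))"
    by (intro Bochner_Integration.integral_cong refl) (auto simp: path_weight_def tau_zero)
  then show ?thesis by (simp add: prob_space)
qed

lemma expectation_path_weight_eq_0:
  "N < k \<Longrightarrow> expectation (path_weight w k N) = 0"
  using \<tau>_ge[of _ k]
  by (intro integral_eq_zero_AE AE_I2) (force simp: path_weight_def)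

text \<open>The path weight is a function of the increments 0 to \<open>k - 1\<close>, hence
  independent of increment \<open>k\<close>, whose law is \<open>K\<close>.\<close>

lemma expectation_path_weight_incr:
  assumes w: "\<And>n. 0 \<le> w n" and d: "d \<ge> 1"
  shows "expectation (\<lambda>x. path_weight w k m x * of_bool (incr k x = d))
       = expectation (path_weight w k m) * K d"
proof -
  \<comment> \<open>\<open>f\<close> is the path weight in terms of the increments \<open>v\<close>,
    whose partial sums are the renewal times.\<close>
  define f :: "(nat \<Rightarrow> nat) \<Rightarrow> real" where
    "f v = of_bool (sum v {..<k} = m) * (\<Prod>j<k. w (sum v {..<Suc j}))" for v
  let ?I = "Pi\<^sub>M {..<k} (\<lambda>_. count_space (UNIV :: nat set))"
  let ?J = "Pi\<^sub>M {k} (\<lambda>_. count_space (UNIV :: nat set))"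
  let ?X = "\<lambda>x. restrict (\<lambda>i. incr i x) {..<k}" and ?Y = "\<lambda>x. restrict (\<lambda>i. incr i x) {k}"
  have m: "(\<lambda>v. sum v {..<j}) \<in> measurable ?I (count_space UNIV)" if "j \<le> k" for j
    using that by (intro measurable_sum_nat measurable_component_singleton) auto
  have "indep_var ?I ?X ?J ?Y"
    using increments_indep unfolding incr_def[symmetric]
    by (intro indep_var_restrict[of _ _ UNIV]) auto
  moreover have f: "f \<in> borel_measurable ?I"
    unfolding f_def[abs_def]
    by (intro borel_measurable_times borel_measurable_prod
        measurable_compose[OF m] ) auto
  moreover have "(\<lambda>v. of_bool (v k = d) :: real) \<in> borel_measurable ?J"
    by (intro measurable_compose[OF measurable_component_singleton[of k]]) auto
  ultimately have ind: "indep_var borel (f \<circ> ?X) borel ((\<lambda>v. of_bool (v k = d) :: real) \<circ> ?Y)"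
    by (rule indep_var_compose)
  have fX: "(f \<circ> ?X) x = path_weight w k m x" if "x \<in> space P" for x
    using that by (auto simp: f_def path_weight_def \<tau>_eq_sum intro!: prod.cong arg_cong[of _ _ w] sum.cong)
  have Y: "((\<lambda>v. of_bool (v k = d)) \<circ> ?Y) = (\<lambda>x. of_bool (incr k x = d) :: real)"
    by (simp add: fun_eq_iff)
  have "integrable P (f \<circ> ?X) \<longleftrightarrow> integrable P (path_weight w k m)"
    using fX by (intro Bochner_Integration.integrable_cong) auto
  then have i1: "integrable P (f \<circ> ?X)" using path_weight_integrable w by blast
  have i2: "integrable P (\<lambda>x. of_bool (incr k x = d) :: real)"
    by (intro integrable_const_bound[of _ 1]) auto
  have "expectation (\<lambda>x. path_weight w k m x * of_bool (incr k x = d))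
      = expectation (\<lambda>x. (f \<circ> ?X) x * of_bool (incr k x = d))"
    using fX by (intro Bochner_Integration.integral_cong) auto
  also have "\<dots> = expectation (f \<circ> ?X) * expectation (\<lambda>x. of_bool (incr k x = d))"
    using indep_var_lebesgue_integral[OF ind i1] i2 unfolding Y by blast
  also have "expectation (f \<circ> ?X) = expectation (path_weight w k m)"
    using fX by (intro Bochner_Integration.integral_cong) auto
  also have "expectation (\<lambda>x. of_bool (incr k x = d)) = K d"
  proof -
    have "expectation (\<lambda>x. of_bool (incr k x = d)) = expectation (indicator {x \<in> space P. incr k x = d})"
      by (intro Bochner_Integration.integral_cong) (auto simp: indicator_def)
    also have "\<dots> = prob {x \<in> space P. incr k x = d}" by simp
    finally show ?thesis using increments_law[OF d, of k] by (simp add: incr_def)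
  qed
  finally show ?thesis .
qed

text \<open>Splits by the position \<open>m\<close> of the \<open>k\<close>-th renewal; for a given
  \<open>x\<close> only \<open>m = \<tau> k x\<close> can contribute.\<close>

lemma path_weight_Suc:
  assumes "x \<in> space P"
  shows "path_weight w (Suc k) N x
       = (\<Sum>m<N. w N * (path_weight w k m x * of_bool (incr k x = N - m)))"
proof -
  have \<tau>: "\<tau> (Suc k) x = \<tau> k x + incr k x" "0 < incr k x"
    using tau_strict[OF assms, of k] by (auto simp: incr_def)
  have *: "path_weight w k m x * of_bool (incr k x = N - m) =
      (if m = \<tau> k x then of_bool (\<tau> (Suc k) x = N) * (\<Prod>j<k. w (\<tau> (Suc j) x)) else 0)" if "m < N" for m
    using \<tau> that by (auto simp: path_weight_def)
  have "(\<Sum>m<N. w N * (path_weight w k m x * of_bool (incr k x = N - m)))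
     = w N * (\<Sum>m<N. (if m = \<tau> k x then of_bool (\<tau> (Suc k) x = N) * (\<Prod>j<k. w (\<tau> (Suc j) x)) else 0))"
    by (simp add: * sum_distrib_left[symmetric])
  also have "\<dots> = path_weight w (Suc k) N x"
    using \<tau> by (auto simp: path_weight_def)
  finally show ?thesis by simp
qed

lemma expectation_path_weight_Suc:
  assumes w: "\<And>n. 0 \<le> w n"
  shows "expectation (path_weight w (Suc k) N)
       = w N * (\<Sum>m<N. K (N - m) * expectation (path_weight w k m))"
proof -
  have int: "integrable P (\<lambda>x. path_weight w k m x * of_bool (incr k x = d))" for m d
    using path_weight_integrable[of w k m, OF w]
    by (rule Bochner_Integration.integrable_bound) (auto simp: abs_mult)
  have "expectation (path_weight w (Suc k) N)
      = expectation (\<lambda>x. \<Sum>m<N. w N * (path_weight w k m x * of_bool (incr k x = N - m)))"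
    by (intro Bochner_Integration.integral_cong refl path_weight_Suc)
  also have "\<dots> = (\<Sum>m<N. w N * (expectation (path_weight w k m) * K (N - m)))"
    using int w by (subst Bochner_Integration.integral_sum)
       (auto intro!: sum.cong simp: expectation_path_weight_incr)
  finally show ?thesis by (simp add: sum_distrib_left mult_ac)
qed

text \<open>One more renewal amounts to one step of the last-jump recursion; summing over the number
  \<open>k\<close> of renewals gives the recursion of \<open>pinned\<close>.\<close>

lemma pinned_eq_sum_path_weight:
  assumes w: "\<And>n. 0 \<le> w n"
  shows "pinned K w N = (\<Sum>k\<le>N. expectation (path_weight w k N))"
proof (induction N rule: less_induct)
  case (less N)
  show ?case
  proof (cases "N = 0")
    case True
    then show ?thesis by (simp add: expectation_path_weight_0)
  next
    case False
    \<comment> \<open>A path to \<open>m < N\<close> has at most \<open>m\<close> renewals, so all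
      inner sums may run over the same range and the two summations can be exchanged.\<close>
    have extend: "(\<Sum>k\<le>m. expectation (path_weight w k m)) = (\<Sum>k<N. expectation (path_weight w k m))"
      if "m < N" for m
      using that by (intro sum.mono_neutral_left) (auto simp: expectation_path_weight_eq_0)
    obtain N' where N': "N = Suc N'" using False not0_implies_Suc by blast
    have "(\<Sum>k\<le>N. expectation (path_weight w k N))
        = (\<Sum>k<N. expectation (path_weight w (Suc k) N))"
      unfolding N' sum.atMost_Suc_shift by (simp add: expectation_path_weight_0 lessThan_Suc_atMost)
    also have "\<dots> = w N * (\<Sum>k<N. \<Sum>m<N. K (N - m) * expectation (path_weight w k m))"
      by (simp add: expectation_path_weight_Suc w sum_distrib_left)
    also have "\<dots> = w N * (\<Sum>m<N. K (N - m) * (\<Sum>k<N. expectation (path_weight w k m)))"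
      by (subst sum.swap) (simp add: sum_distrib_left)
    also have "\<dots> = pinned K w N"
      using False less by (simp add: pinned_pos_eq extend)
    finally show ?thesis by simp
  qed
qed

text \<open>If \<open>N\<close> is a renewal, it is the \<open>k\<close>-th one for exactly one
  \<open>k\<close>, and \<open>k \<le> N\<close> because the times strictly increase; otherwise both
  sides vanish.\<close>

lemma exp_contact_eq_sum_path_weight:
  assumes x: "x \<in> space P"
  shows "exp (\<Sum>n=1..N. a n * contact \<tau> n x) * contact \<tau> N x
       = (\<Sum>k\<le>N. path_weight (\<lambda>n. exp (a n)) k N x)"
proof (cases "N \<in> range (\<lambda>j. \<tau> j x)")
  case False
  then have "contact \<tau> N x = 0" "\<tau> k x \<noteq> N" for k by (auto simp: contact_def)
  then show ?thesis by (simp add: path_weight_def)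
next
  case True
  then obtain k where k: "N = \<tau> k x" by auto
  have "k \<le> N" using \<tau>_ge[OF x] k by simp
  have "(\<Sum>l\<le>N. path_weight (\<lambda>n. exp (a n)) l N x)
      = (\<Sum>l\<le>N. if l = k then (\<Prod>j<k. exp (a (\<tau> (Suc j) x))) else 0)"
    by (intro sum.cong) (auto simp: path_weight_def k \<tau>_inj[OF x])
  also have "\<dots> = exp (\<Sum>j<k. a (\<tau> (Suc j) x))"
    using \<open>k \<le> N\<close> by (simp add: exp_sum)
  also have "(\<Sum>j<k. a (\<tau> (Suc j) x)) = (\<Sum>n\<in>(\<lambda>j. \<tau> (Suc j) x) ` {..<k}. a n)"
    by (subst sum.reindex) (auto simp: inj_on_def \<tau>_inj[OF x])
  also have "(\<lambda>j. \<tau> (Suc j) x) ` {..<k} = {1..N} \<inter> range (\<lambda>j. \<tau> j x)"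
  proof (safe)
    fix j assume "j < k"
    then show "\<tau> (Suc j) x \<in> {1..N}"
      using \<tau>_ge[OF x, of "Suc j"] \<tau>_le_iff[OF x, of "Suc j" k] k by auto
  next
    fix j assume j: "\<tau> j x \<in> {1..N}"
    then have "j \<noteq> 0" using tau_zero[OF x] by (cases j) auto
    then obtain i where i: "j = Suc i" using not0_implies_Suc by blast
    have "j \<le> k" using j k \<tau>_le_iff[OF x] by auto
    then show "\<tau> j x \<in> (\<lambda>j. \<tau> (Suc j) x) ` {..<k}" using i by auto
  qed auto
  also have "(\<Sum>n\<in>{1..N} \<inter> range (\<lambda>j. \<tau> j x). a n) = (\<Sum>n=1..N. a n * contact \<tau> n x)"
    by (subst sum.inter_restrict[of "{1..N}" a "range (\<lambda>j. \<tau> j x)"],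
        simp, rule sum.cong) (auto simp: contact_def indicator_def)
  finally show ?thesis using True by (simp add: contact_def)
qed

lemma expectation_exp_contact:
  "expectation (\<lambda>x. exp (\<Sum>n=1..N. a n * contact \<tau> n x) * contact \<tau> N x)
     = pinned K (\<lambda>n. exp (a n)) N"
proof -
  have "expectation (\<lambda>x. exp (\<Sum>n=1..N. a n * contact \<tau> n x) * contact \<tau> N x)
      = expectation (\<lambda>x. \<Sum>k\<le>N. path_weight (\<lambda>n. exp (a n)) k N x)"
    by (intro Bochner_Integration.integral_cong refl exp_contact_eq_sum_path_weight)
  also have "\<dots> = (\<Sum>k\<le>N. expectation (path_weight (\<lambda>n. exp (a n)) k N))"
    by (intro Bochner_Integration.integral_sum path_weight_integrable) simp
  finally show ?thesis by (simp add: pinned_eq_sum_path_weight)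
qed

end

section \<open>Disorder variables\<close>

context disorder
begin

lemma omega_measurable: "n \<ge> 1 \<Longrightarrow> \<omega> n \<in> borel_measurable Q"
  using omega_indep by (auto simp: indep_vars_def)

lemma omega_integrable_iff:
  fixes g :: "real \<Rightarrow> real"
  assumes "n \<ge> 1" "g \<in> borel_measurable borel"
  shows "integrable Q (\<lambda>y. g (\<omega> n y)) \<longleftrightarrow> integrable Q (\<lambda>y. g (\<omega> 1 y))"
proof -
  have "integrable (distr Q borel (\<omega> m)) g \<longleftrightarrow> integrable Q (\<lambda>y. g (\<omega> m y))" if "m \<ge> 1" for m
    using assms omega_measurable[OF that] by (intro integrable_distr_eq)
  from this[of n] this[of 1] show ?thesis using assms omega_ident[OF assms(1)] by simp
qed

lemma omega_expectation_eq:
  fixes g :: "real \<Rightarrow> real"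
  assumes "n \<ge> 1" "g \<in> borel_measurable borel"
  shows "expectation (\<lambda>y. g (\<omega> n y)) = expectation (\<lambda>y. g (\<omega> 1 y))"
proof -
  have "integral\<^sup>L (distr Q borel (\<omega> m)) g = expectation (\<lambda>y. g (\<omega> m y))" if "m \<ge> 1" for m
    using assms omega_measurable[OF that] by (intro integral_distr)
  from this[of n] this[of 1] show ?thesis using assms omega_ident[OF assms(1)] by simp
qed

lemma omega_integrable:
  assumes "n \<ge> 1" shows "integrable Q (\<omega> n)"
proof -
  have "integrable Q (\<lambda>y. exp (1 * \<omega> 1 y) + exp (- 1 * \<omega> 1 y))"
    by (intro Bochner_Integration.integrable_add omega_exp_moments)
  then have "integrable Q (\<omega> 1)"
  proof (rule Bochner_Integration.integrable_bound)
    have "\<bar>x\<bar> \<le> exp x + exp (- x)" for x :: real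
      using exp_ge_add_one_self[of x] exp_ge_add_one_self[of "- x"] exp_gt_zero[of x] exp_gt_zero[of "-x"]
      by linarith
    then show "AE y in Q. norm (\<omega> 1 y) \<le> norm (exp (1 * \<omega> 1 y) + exp (- 1 * \<omega> 1 y))"
      by (intro AE_I2) (simp add: add_nonneg_nonneg)
  qed (use omega_measurable in simp)
  then show ?thesis using omega_integrable_iff[OF assms, of "\<lambda>x. x"] by simp
qed

lemma omega_expectation: "n \<ge> 1 \<Longrightarrow> expectation (\<omega> n) = 0"
  using omega_expectation_eq[of n "\<lambda>x. x"] omega_mean by simp

lemma mgf_ge_1: "mgf Q \<omega> t \<ge> 1"
proof -
  have "expectation (\<lambda>y. 1 + t * \<omega> 1 y) \<le> mgf Q \<omega> t"
    unfolding mgf_def using omega_integrable[of 1]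
    by (intro integral_mono omega_exp_moments Bochner_Integration.integrable_add) auto
  moreover have "expectation (\<lambda>y. 1 + t * \<omega> 1 y) = 1"
    using omega_integrable[of 1] by (simp add: prob_space omega_expectation)
  ultimately show ?thesis by simp
qed

lemma mgf_pos: "mgf Q \<omega> t > 0"
  using mgf_ge_1[of t] by linarith

lemma mgf_0 [simp]: "mgf Q \<omega> 0 = 1"
  by (simp add: mgf_def prob_space)

lemma mgf_eq: "n \<ge> 1 \<Longrightarrow> expectation (\<lambda>y. exp (t * \<omega> n y)) = mgf Q \<omega> t"
  unfolding mgf_def by (rule omega_expectation_eq) simp_all

lemma exp_omega_integrable: "n \<ge> 1 \<Longrightarrow> integrable Q (\<lambda>y. exp (t * \<omega> n y))"
  using omega_integrable_iff[of n "\<lambda>x. exp (t * x)"] omega_exp_moments by simp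

text \<open>Integrating the convexity of \<open>exp\<close> yields a finite convex function on the
  whole line, which is continuous.\<close>

lemma mgf_continuous: "continuous_on UNIV (mgf Q \<omega>)"
proof (rule convex_on_continuous)
  have "mgf Q \<omega> ((1 - u) *\<^sub>R s + u *\<^sub>R t) \<le> (1 - u) * mgf Q \<omega> s + u * mgf Q \<omega> t"
    if u: "0 < u" "u < 1" for u s t :: real
  proof -
    have "exp (((1 - u) *\<^sub>R s + u *\<^sub>R t) * x) \<le> (1 - u) * exp (s * x) + u * exp (t * x)" for x
    proof -
      have "exp ((1 - u) *\<^sub>R (s * x) + u *\<^sub>R (t * x)) \<le> (1 - u) * exp (s * x) + u * exp (t * x)"
        using convex_onD[OF exp_convex, of u "s * x" "t * x"] u by simp
      then show ?thesis by (simp add: algebra_simps)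
    qed
    then have "mgf Q \<omega> ((1 - u) *\<^sub>R s + u *\<^sub>R t)
        \<le> expectation (\<lambda>y. (1 - u) * exp (s * \<omega> 1 y) + u * exp (t * \<omega> 1 y))"
      unfolding mgf_def using omega_exp_moments
      by (intro integral_mono) auto
    also have "\<dots> = (1 - u) * mgf Q \<omega> s + u * mgf Q \<omega> t"
      unfolding mgf_def using omega_exp_moments by simp
    finally show ?thesis .
  qed
  then show "convex_on UNIV (mgf Q \<omega>)" by (intro convex_onI) auto
qed simp

section \<open>Shift invariance of the disorder law\<close>

lemma distr_omega_shift:
  assumes "0 < M"
  shows "distr Q (Pi\<^sub>M {1..M} (\<lambda>_. borel)) (\<lambda>y. \<lambda>i\<in>{1..M}. \<omega> (N + i) y)
     = Pi\<^sub>M {1..M} (\<lambda>_. distr Q borel (\<omega> 1))"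
proof -
  let ?D = "\<lambda>_::nat. distr Q borel (\<omega> 1)"
  let ?K = "{1..N + M}" and ?J = "{1..M}"
  have D: "prob_space (distr Q borel (\<omega> 1))"
    using omega_measurable by (intro prob_space_distr) simp
  have "distr Q (Pi\<^sub>M ?K (\<lambda>_. borel)) (\<lambda>y. \<lambda>i\<in>?K. \<omega> i y) = Pi\<^sub>M ?K (\<lambda>i. distr Q borel (\<omega> i))"
    using assms omega_measurable
    by (intro indep_vars_iff_distr_eq_PiM'[THEN iffD1] indep_vars_subset[OF omega_indep]) auto
  also have "\<dots> = Pi\<^sub>M ?K ?D"
    by (intro PiM_cong refl omega_ident) auto
  finally have K: "distr Q (Pi\<^sub>M ?K (\<lambda>_. borel)) (\<lambda>y. \<lambda>i\<in>?K. \<omega> i y) = Pi\<^sub>M ?K ?D" .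
  \<comment> \<open>The block after \<open>N\<close> is read off from the first \<open>N + M\<close>
    variables through the injection \<open>n \<mapsto> N + n\<close>, which maps a product of equal
    factors to such a product.\<close>
  have "Pi\<^sub>M ?J ?D = distr (Pi\<^sub>M ?K ?D) (Pi\<^sub>M ?J ?D) (\<lambda>v. \<lambda>n\<in>?J. v (N + n))"
    using D by (intro distr_PiM_reindex[symmetric]) auto
  also have "\<dots> = distr (Pi\<^sub>M ?K ?D) (Pi\<^sub>M ?J (\<lambda>_. borel)) (\<lambda>v. \<lambda>n\<in>?J. v (N + n))"
    by (intro distr_cong sets_PiM_cong) auto
  also have "\<dots> = distr Q (Pi\<^sub>M ?J (\<lambda>_. borel)) ((\<lambda>v. \<lambda>n\<in>?J. v (N + n)) \<circ> (\<lambda>y. \<lambda>i\<in>?K. \<omega> i y))"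
    unfolding K[symmetric] using omega_measurable
    by (intro distr_distr measurable_restrict measurable_component_singleton) auto
  also have "(\<lambda>v. \<lambda>n\<in>?J. v (N + n)) \<circ> (\<lambda>y. \<lambda>i\<in>?K. \<omega> i y) = (\<lambda>y. \<lambda>i\<in>?J. \<omega> (N + i) y)"
    by (auto simp: fun_eq_iff)
  finally show ?thesis by (rule sym)
qed

lemma expectation_omega_shift:
  fixes f :: "(nat \<Rightarrow> real) \<Rightarrow> real"
  assumes f: "f \<in> borel_measurable (Pi\<^sub>M {1..M} (\<lambda>_. borel))"
  shows "expectation (\<lambda>y. f (\<lambda>i\<in>{1..M}. \<omega> (N + i) y))
       = expectation (\<lambda>y. f (\<lambda>i\<in>{1..M}. \<omega> i y))"
proof (cases "M = 0")
  case False
  have "expectation (\<lambda>y. f (\<lambda>i\<in>{1..M}. \<omega> (n + i) y))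
      = integral\<^sup>L (Pi\<^sub>M {1..M} (\<lambda>_. distr Q borel (\<omega> 1))) f" for n
    using False unfolding distr_omega_shift[symmetric, of M n, OF neq0_conv[THEN iffD1, OF False]] using f omega_measurable
    by (intro integral_distr[symmetric] measurable_restrict) auto
  from this[of N] this[of 0] show ?thesis by simp
qed (simp add: restrict_def)

end

section \<open>The averaged logarithm\<close>

text \<open>Since \<open>X\<close> lies between \<open>c\<close> and \<open>Y\<close>, concavity of \<open>ln\<close> lets the tangent at \<open>c\<close> bound the
  increment. The slope at \<open>c\<close> no longer involves \<open>X\<close>, so it will be independent of \<open>Y - X\<close>.\<close>

lemma ln_affine_le_crossing:
  fixes a b c X Y :: real
  assumes "0 \<le> a" "0 \<le> b" "0 < a + b" "0 < c" "0 < X" "0 < Y"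
    and cross: "c \<le> X \<and> X \<le> Y \<or> Y \<le> X \<and> X \<le> c"
  shows "ln (a + b * Y) - ln (a + b * X) \<le> b / (a + b * c) * (Y - X)"
proof -
  have pos: "0 < a + b * z" if "0 < z" for z
  proof (cases "b = 0")
    case False
    then have "0 < b * z" using that assms by simp
    then show ?thesis using assms by linarith
  qed (use assms in simp)
  have "ln (a + b * Y) - ln (a + b * X) \<le> (a + b * Y - (a + b * X)) / (a + b * X)"
    using pos assms by (intro ln_diff_le) auto
  also have "\<dots> = (b * (Y - X)) / (a + b * X)"
    by (simp add: algebra_simps)
  also have "\<dots> \<le> (b * (Y - X)) / (a + b * c)"
    using cross
  proof
    assume "c \<le> X \<and> X \<le> Y"
    then show ?thesis using assms pos
      by (intro divide_left_mono) (auto intro!: mult_left_mono mult_nonneg_nonneg mult_pos_pos)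
  next
    assume *: "Y \<le> X \<and> X \<le> c"
    then have "(b * (X - Y)) / (a + b * c) \<le> (b * (X - Y)) / (a + b * X)" using assms pos
      by (intro divide_left_mono) (auto intro!: mult_left_mono mult_nonneg_nonneg mult_pos_pos)
    then show ?thesis by (simp add: algebra_simps diff_divide_distrib)
  qed
  finally show ?thesis by simp
qed

section \<open>The expected logarithm in finite volume: bounds, superadditivity, scaling\<close>

locale disordered_renewal = renewal_kernel K + disorder Q \<omega>
  for K :: "nat \<Rightarrow> real" and Q :: "'b measure" and \<omega> :: "nat \<Rightarrow> 'b \<Rightarrow> real"
begin

definition site_energy :: "real \<Rightarrow> real \<Rightarrow> nat \<Rightarrow> 'b \<Rightarrow> real" where
  "site_energy \<beta> h n y = \<beta> * \<omega> n y + h - ln (mgf Q \<omega> \<beta>)"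

definition mean_ln :: "real \<Rightarrow> real \<Rightarrow> nat \<Rightarrow> real" where
  "mean_ln \<beta> h N = expectation (\<lambda>y. ln (pinned K (\<lambda>n. exp (site_energy \<beta> h n y)) N))"

lemma site_energy_integrable: "n \<ge> 1 \<Longrightarrow> integrable Q (site_energy \<beta> h n)"
  unfolding site_energy_def[abs_def] using omega_integrable[of n] by simp

lemma expectation_site_energy:
  "n \<ge> 1 \<Longrightarrow> expectation (site_energy \<beta> h n) = h - ln (mgf Q \<omega> \<beta>)"
  unfolding site_energy_def[abs_def] using omega_integrable[of n]
  by (simp add: omega_expectation prob_space)

lemma exp_site_energy:
  "exp (site_energy \<beta> h n y) = exp (\<beta> * \<omega> n y) * (exp h / mgf Q \<omega> \<beta>)"
  using mgf_pos[of \<beta>] by (simp add: site_energy_def exp_add exp_diff)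

lemma exp_site_energy_integrable:
  "n \<ge> 1 \<Longrightarrow> integrable Q (\<lambda>y. exp (site_energy \<beta> h n y))"
  unfolding exp_site_energy using exp_omega_integrable by simp

text \<open>The normalisation by \<open>ln M(\<beta>)\<close> fixes the mean weight for all \<beta>;
  this makes the first-order term vanish when two values of \<beta> are compared.\<close>

lemma expectation_exp_site_energy:
  "n \<ge> 1 \<Longrightarrow> expectation (\<lambda>y. exp (site_energy \<beta> h n y)) = exp h"
  unfolding exp_site_energy using mgf_pos[of \<beta>] by (simp add: mgf_eq)

lemma mean_ln_integrable:
  "integrable Q (\<lambda>y. ln (pinned K (\<lambda>n. exp (site_energy \<beta> h n y)) N))"
  by (intro integrable_ln_pinned finite_measure_axioms site_energy_integrable)

lemma mean_ln_ge:
  assumes "0 < N" shows "h - ln (mgf Q \<omega> \<beta>) + ln (K N) \<le> mean_ln \<beta> h N"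
proof -
  have "expectation (\<lambda>y. site_energy \<beta> h N y + ln (K N)) \<le> mean_ln \<beta> h N"
    unfolding mean_ln_def using assms site_energy_integrable[of N \<beta> h]
    by (intro integral_mono mean_ln_integrable ln_pinned_ge) auto
  then show ?thesis
    using assms site_energy_integrable[of N \<beta> h] by (simp add: expectation_site_energy prob_space)
qed

lemma mean_ln_le: "mean_ln \<beta> h N \<le> expectation (\<lambda>y. \<bar>site_energy \<beta> h 1 y\<bar>) * real N"
proof -
  have "mean_ln \<beta> h N \<le> expectation (\<lambda>y. \<Sum>n=1..N. \<bar>site_energy \<beta> h n y\<bar>)"
    unfolding mean_ln_def using site_energy_integrable
    by (intro integral_mono mean_ln_integrable ln_pinned_le) auto
  also have "\<dots> = (\<Sum>n=1..N. expectation (\<lambda>y. \<bar>site_energy \<beta> h n y\<bar>))"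
    using site_energy_integrable by (intro Bochner_Integration.integral_sum) auto
  also have "\<dots> = (\<Sum>n=1..N. expectation (\<lambda>y. \<bar>site_energy \<beta> h 1 y\<bar>))"
    unfolding site_energy_def
    by (intro sum.cong refl omega_expectation_eq[where g="\<lambda>x. \<bar>\<beta> * x + h - ln (mgf Q \<omega> \<beta>)\<bar>"]) auto
  finally show ?thesis by (simp add: mult.commute)
qed

text \<open>The disorder is stationary; this turns the pointwise supermultiplicativity of
  \<open>pinned\<close> into superadditivity of the means.\<close>

lemma mean_ln_shift:
  "expectation (\<lambda>y. ln (pinned K (\<lambda>n. exp (site_energy \<beta> h (N + n) y)) M)) = mean_ln \<beta> h M"
proof -
  define f where "f v = ln (pinned K (\<lambda>n. exp (\<beta> * v n + h - ln (mgf Q \<omega> \<beta>))) M)" for v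
  have f: "f \<in> borel_measurable (Pi\<^sub>M {1..M} (\<lambda>_. borel))"
    unfolding f_def[abs_def]
    by (intro borel_measurable_ln pinned_measurable borel_measurable_exp borel_measurable_diff
        borel_measurable_add borel_measurable_times borel_measurable_const
        measurable_component_singleton) auto
  have "ln (pinned K (\<lambda>n. exp (site_energy \<beta> h (k + n) y)) M) = f (\<lambda>i\<in>{1..M}. \<omega> (k + i) y)" for k y
    unfolding f_def by (intro arg_cong[of _ _ ln] pinned_cong) (auto simp: site_energy_def)
  from this this[of 0] expectation_omega_shift[OF f, of N] show ?thesis
    by (simp add: mean_ln_def)
qed

lemma mean_ln_superadditive: "mean_ln \<beta> h N + mean_ln \<beta> h M \<le> mean_ln \<beta> h (N + M)"
proof -
  let ?w = "\<lambda>y n. exp (site_energy \<beta> h n y)"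
  have int: "integrable Q (\<lambda>y. ln (pinned K (\<lambda>n. ?w y (N + n)) M))"
    by (intro integrable_ln_pinned finite_measure_axioms site_energy_integrable) simp
  have "mean_ln \<beta> h N + mean_ln \<beta> h M
      = expectation (\<lambda>y. ln (pinned K (?w y) N) + ln (pinned K (\<lambda>n. ?w y (N + n)) M))"
    using int mean_ln_integrable by (simp add: mean_ln_shift) (simp add: mean_ln_def)
  also have "\<dots> \<le> mean_ln \<beta> h (N + M)"
    unfolding mean_ln_def
  proof (intro integral_mono Bochner_Integration.integrable_add mean_ln_integrable int)
    fix y
    have "ln (pinned K (?w y) N) + ln (pinned K (\<lambda>n. ?w y (N + n)) M)
        = ln (pinned K (?w y) N * pinned K (\<lambda>n. ?w y (N + n)) M)"
      by (intro ln_mult_pos[symmetric] pinned_pos) auto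
    also have "\<dots> \<le> ln (pinned K (?w y) (N + M))"
      by (intro ln_mono pinned_supermultiplicative mult_pos_pos pinned_pos) auto
    finally show "ln (pinned K (?w y) N) + ln (pinned K (\<lambda>n. ?w y (N + n)) M)
        \<le> ln (pinned K (?w y) (N + M))" .
  qed
  finally show ?thesis .
qed

lemma mean_ln_zero_nonpos:
  assumes "h \<le> 0" shows "mean_ln 0 h N \<le> 0"
proof -
  have "pinned K (\<lambda>n. exp (site_energy 0 h n y)) N \<le> (\<Prod>n=1..N. 1)" for y
    using assms by (intro pinned_le_prod) (auto simp: site_energy_def)
  then have "ln (pinned K (\<lambda>n. exp (site_energy 0 h n y)) N) \<le> 0" for y
    using pinned_pos[of "\<lambda>n. exp (site_energy 0 h n y)" N] by simp
  then have "mean_ln 0 h N \<le> expectation (\<lambda>y. 0)"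
    unfolding mean_ln_def by (intro integral_mono mean_ln_integrable) auto
  then show ?thesis by simp
qed

text \<open>The new field is chosen so that each site energy becomes exactly \<open>s\<close> times
  the old one, and \<open>pinned_powr_le\<close> applies pointwise.\<close>

lemma mean_ln_scale:
  assumes "0 < s" "s \<le> 1"
  shows "mean_ln (s * \<beta>) (s * (h - ln (mgf Q \<omega> \<beta>)) + ln (mgf Q \<omega> (s * \<beta>))) N \<le> s * mean_ln \<beta> h N"
    (is "mean_ln _ ?h' N \<le> _")
proof -
  have "mean_ln (s * \<beta>) ?h' N
      \<le> expectation (\<lambda>y. s * ln (pinned K (\<lambda>n. exp (site_energy \<beta> h n y)) N))"
    unfolding mean_ln_def
  proof (intro integral_mono mean_ln_integrable integrable_mult_right)
    fix y
    let ?w = "\<lambda>n. exp (site_energy \<beta> h n y)"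
    have "(\<lambda>n. exp (site_energy (s * \<beta>) ?h' n y)) = (\<lambda>n. ?w n powr s)"
      by (auto simp: powr_def site_energy_def algebra_simps)
    then have "ln (pinned K (\<lambda>n. exp (site_energy (s * \<beta>) ?h' n y)) N) \<le> ln (pinned K ?w N powr s)"
      using assms pinned_powr_le[of ?w s N] by (auto intro!: ln_mono pinned_pos simp del: ln_powr)
    also have "\<dots> = s * ln (pinned K ?w N)"
      using pinned_pos[of ?w N] by (simp add: ln_powr)
    finally show "ln (pinned K (\<lambda>n. exp (site_energy (s * \<beta>) ?h' n y)) N) \<le> s * ln (pinned K ?w N)" .
  qed
  then show ?thesis by (simp add: mean_ln_def)
qed

section \<open>Monotonicity in \<beta> by exchanging the weights one site at a time\<close>

lemma exp_site_energy_crossing: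
  fixes h :: real
  assumes "0 \<le> \<beta>" "\<beta> < \<beta>'"
  obtains c where "0 < c"
    "\<And>n y. c \<le> exp (site_energy \<beta> h n y) \<and> exp (site_energy \<beta> h n y) \<le> exp (site_energy \<beta>' h n y)
      \<or> exp (site_energy \<beta>' h n y) \<le> exp (site_energy \<beta> h n y) \<and> exp (site_energy \<beta> h n y) \<le> c"
proof
  let ?l = "\<lambda>b. ln (mgf Q \<omega> b)"
  \<comment> \<open>Both site energies are affine in the disorder, with slopes \<beta> < \<beta>',
    and they agree at \<open>x\<close>. The common weight there serves as \<open>c\<close>; since
    \<beta> \<ge> 0, the weight at \<beta> passes \<open>c\<close> in the same direction.\<close>
  define x where "x = (?l \<beta>' - ?l \<beta>) / (\<beta>' - \<beta>)"
  have x: "(\<beta>' - \<beta>) * x = ?l \<beta>' - ?l \<beta>" using assms by (simp add: x_def)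
  show "0 < exp (\<beta> * x + h - ?l \<beta>)" by simp
  fix n y
  show "exp (\<beta> * x + h - ?l \<beta>) \<le> exp (site_energy \<beta> h n y)
        \<and> exp (site_energy \<beta> h n y) \<le> exp (site_energy \<beta>' h n y)
      \<or> exp (site_energy \<beta>' h n y) \<le> exp (site_energy \<beta> h n y)
        \<and> exp (site_energy \<beta> h n y) \<le> exp (\<beta> * x + h - ?l \<beta>)"
  proof (cases "x \<le> \<omega> n y")
    case True
    then have "\<beta> * x \<le> \<beta> * \<omega> n y" "(\<beta>' - \<beta>) * x \<le> (\<beta>' - \<beta>) * \<omega> n y"
      using assms by (auto intro: mult_left_mono)
    then show ?thesis using x by (simp add: site_energy_def algebra_simps)
  next
    case False
    then have "\<beta> * \<omega> n y \<le> \<beta> * x" "(\<beta>' - \<beta>) * \<omega> n y \<le> (\<beta>' - \<beta>) * x"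
      using assms by (auto intro: mult_left_mono)
    then show ?thesis using x by (simp add: site_energy_def algebra_simps)
  qed
qed

text \<open>Interpolates between the two models: \<open>k = 0\<close> is the one at \<beta>, and in
  volume \<open>N\<close> the choice \<open>k = N\<close> is the one at \<beta>'.\<close>

definition mixed_energy :: "real \<Rightarrow> real \<Rightarrow> real \<Rightarrow> nat \<Rightarrow> nat \<Rightarrow> 'b \<Rightarrow> real" where
  "mixed_energy \<beta> \<beta>' h k n y = (if n \<le> k then site_energy \<beta>' h n y else site_energy \<beta> h n y)"

lemma mixed_energy_integrable: "n \<ge> 1 \<Longrightarrow> integrable Q (mixed_energy \<beta> \<beta>' h k n)"
  unfolding mixed_energy_def[abs_def] using site_energy_integrable[of n] by (cases "n \<le> k") auto

text \<open>With all other sites fixed, the tangent bound controls the increment by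
  \<open>g * (Y - X)\<close>, where \<open>X\<close> and \<open>Y\<close> are the old and new
  weights of site \<open>Suc k\<close>. The slope \<open>g\<close> depends only on the other sites,
  so independence and equal means make the expectation zero.\<close>

lemma mixed_energy_step:
  assumes "0 \<le> \<beta>" "\<beta> < \<beta>'"
  shows "expectation (\<lambda>y. ln (pinned K (\<lambda>n. exp (mixed_energy \<beta> \<beta>' h (Suc k) n y)) N))
       \<le> expectation (\<lambda>y. ln (pinned K (\<lambda>n. exp (mixed_energy \<beta> \<beta>' h k n y)) N))"
proof -
  define i where "i = Suc k"
  let ?X = "\<lambda>y. exp (site_energy \<beta> h i y)" and ?Y = "\<lambda>y. exp (site_energy \<beta>' h i y)"
  have i: "i \<ge> 1" by (simp add: i_def)
  obtain c where c: "0 < c" "\<And>n y. c \<le> exp (site_energy \<beta> h n y) \<and> exp (site_energy \<beta> h n y) \<le> exp (site_energy \<beta>' h n y)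
      \<or> exp (site_energy \<beta>' h n y) \<le> exp (site_energy \<beta> h n y) \<and> exp (site_energy \<beta> h n y) \<le> c"
    using exp_site_energy_crossing[OF assms] by blast
  \<comment> \<open>The mixed weights as a function of a disorder vector \<open>v\<close>. The value
    at \<open>i\<close> is overwritten below, so \<open>a\<close>, \<open>b\<close> and
    \<open>g\<close> do not see coordinate \<open>i\<close>.\<close>
  let ?u = "\<lambda>v n. exp (if n \<le> k then \<beta>' * v n + h - ln (mgf Q \<omega> \<beta>') else \<beta> * v n + h - ln (mgf Q \<omega> \<beta>))"
  define a where "a v = pinned K ((?u v)(i := 0)) N" for v
  define b where "b v = pinned K ((?u v)(i := 1)) N - a v" for v
  define g where "g v = b v / (a v + b v * c)" for v
  have a0: "0 \<le> a v" for v unfolding a_def by (intro pinned_nonneg) auto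
  have b0: "0 \<le> b v" for v
  proof -
    have "a v \<le> pinned K ((?u v)(i := 1)) N" unfolding a_def by (intro pinned_mono) auto
    then show ?thesis by (simp add: b_def)
  qed
  have ab: "0 < a v + b v" for v
  proof -
    have "0 < pinned K ((?u v)(i := 1)) N" by (intro pinned_pos) auto
    then show ?thesis by (simp add: b_def)
  qed
  have split: "pinned K ((?u v)(i := z)) N = a v + b v * z" for v z
    using pinned_affine[of K "?u v" i z N] by (simp add: a_def b_def mult.commute)
  let ?om = "\<lambda>y. restrict (\<lambda>n. \<omega> n y) ({1..N} - {i})"
  have eqX: "pinned K (\<lambda>n. exp (mixed_energy \<beta> \<beta>' h k n y)) N = a (?om y) + b (?om y) * ?X y" for y
    unfolding split[symmetric] by (intro pinned_cong) (auto simp: mixed_energy_def site_energy_def i_def)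
  have eqY: "pinned K (\<lambda>n. exp (mixed_energy \<beta> \<beta>' h (Suc k) n y)) N = a (?om y) + b (?om y) * ?Y y" for y
    unfolding split[symmetric] by (intro pinned_cong) (auto simp: mixed_energy_def site_energy_def i_def)
  let ?I = "Pi\<^sub>M ({1..N} - {i}) (\<lambda>_. borel :: real measure)"
  have u_meas: "(\<lambda>v. ((?u v)(i := z)) n) \<in> borel_measurable ?I" if "1 \<le> n" "n \<le> N" for z n
  proof (cases "n = i")
    case False
    then have [measurable]: "(\<lambda>v. v n) \<in> borel_measurable ?I"
      using that by (intro measurable_component_singleton) auto
    have "(\<lambda>v. exp (\<beta>' * v n + h - ln (mgf Q \<omega> \<beta>'))) \<in> borel_measurable ?I"
      "(\<lambda>v. exp (\<beta> * v n + h - ln (mgf Q \<omega> \<beta>))) \<in> borel_measurable ?I"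
      by measurable
    then show ?thesis using False by (cases "n \<le> k") (simp_all del: One_nat_def)
  qed simp
  have a_meas [measurable]: "a \<in> borel_measurable ?I"
    unfolding a_def[abs_def] by (intro pinned_measurable u_meas)
  have [measurable]: "b \<in> borel_measurable ?I"
    unfolding b_def[abs_def] by (intro borel_measurable_diff a_meas pinned_measurable u_meas)
  have g_meas: "g \<in> borel_measurable ?I" unfolding g_def[abs_def] by measurable
  have g_bound: "\<bar>g v\<bar> \<le> 1 / c" for v
  proof (cases "b v = 0")
    case False
    then have "0 < b v * c" using b0[of v] c by simp
    then have "b v / (a v + b v * c) \<le> b v / (b v * c)"
      using a0[of v] b0[of v] by (intro divide_left_mono) (auto intro!: mult_pos_pos add_nonneg_pos)
    then show ?thesis using False a0[of v] b0[of v] c by (simp add: g_def)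
  qed (use c in \<open>simp add: g_def\<close>)
  have XY_int: "integrable Q (\<lambda>y. ?Y y - ?X y)"
    using exp_site_energy_integrable[OF i] by simp
  have om_meas: "?om \<in> measurable Q ?I"
    using omega_measurable by (intro measurable_restrict) auto
  have g_int: "integrable Q (\<lambda>y. g (?om y))"
    using g_bound by (intro integrable_const_bound[of _ "1 / c"] measurable_compose[OF om_meas g_meas]) auto
  have ind: "indep_var borel (\<lambda>y. g (?om y)) borel (\<lambda>y. ?Y y - ?X y)"
  proof -
    let ?J = "Pi\<^sub>M {i} (\<lambda>_. borel :: real measure)"
    let ?f = "\<lambda>v. exp (\<beta>' * v i + h - ln (mgf Q \<omega> \<beta>')) - exp (\<beta> * v i + h - ln (mgf Q \<omega> \<beta>))"
    have [measurable]: "(\<lambda>v. v i) \<in> borel_measurable ?J"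
      by (intro measurable_component_singleton) auto
    have "indep_var ?I ?om ?J (\<lambda>y. restrict (\<lambda>n. \<omega> n y) {i})"
      using i by (intro indep_var_restrict[OF omega_indep]) auto
    moreover have "?f \<in> borel_measurable ?J" by measurable
    ultimately have "indep_var borel (g \<circ> ?om) borel (?f \<circ> (\<lambda>y. restrict (\<lambda>n. \<omega> n y) {i}))"
      using g_meas by (intro indep_var_compose)
    then show ?thesis by (simp add: comp_def site_energy_def)
  qed
  have "expectation (\<lambda>y. ln (a (?om y) + b (?om y) * ?Y y)) - expectation (\<lambda>y. ln (a (?om y) + b (?om y) * ?X y))
      = expectation (\<lambda>y. ln (a (?om y) + b (?om y) * ?Y y) - ln (a (?om y) + b (?om y) * ?X y))"
    unfolding eqX[symmetric] eqY[symmetric]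
    by (intro Bochner_Integration.integral_diff[symmetric] integrable_ln_pinned finite_measure_axioms mixed_energy_integrable)
  also have "\<dots> \<le> expectation (\<lambda>y. g (?om y) * (?Y y - ?X y))"
  proof (rule integral_mono)
    show "integrable Q (\<lambda>y. ln (a (?om y) + b (?om y) * ?Y y) - ln (a (?om y) + b (?om y) * ?X y))"
      unfolding eqX[symmetric] eqY[symmetric]
      by (intro Bochner_Integration.integrable_diff integrable_ln_pinned finite_measure_axioms mixed_energy_integrable)
    show "integrable Q (\<lambda>y. g (?om y) * (?Y y - ?X y))"
      by (rule indep_var_integrable[OF ind g_int XY_int])
    show "ln (a (?om y) + b (?om y) * ?Y y) - ln (a (?om y) + b (?om y) * ?X y)
        \<le> g (?om y) * (?Y y - ?X y)" for y
      unfolding g_def using c a0 b0 ab by (intro ln_affine_le_crossing) auto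
  qed
  also have "\<dots> = expectation (\<lambda>y. g (?om y)) * expectation (\<lambda>y. ?Y y - ?X y)"
    by (rule indep_var_lebesgue_integral[OF ind g_int XY_int])
  also have "expectation (\<lambda>y. ?Y y - ?X y) = 0"
    using i exp_site_energy_integrable[OF i] by (simp add: expectation_exp_site_energy)
  finally show ?thesis unfolding eqX eqY by (simp only: mult_zero_right diff_le_0_iff_le)
qed

lemma mean_ln_antimono:
  assumes "0 \<le> \<beta>" "\<beta> \<le> \<beta>'"
  shows "mean_ln \<beta>' h N \<le> mean_ln \<beta> h N"
proof (cases "\<beta> = \<beta>'")
  case False
  let ?E = "\<lambda>k. expectation (\<lambda>y. ln (pinned K (\<lambda>n. exp (mixed_energy \<beta> \<beta>' h k n y)) N))"
  have "pinned K (\<lambda>n. exp (mixed_energy \<beta> \<beta>' h 0 n y)) N = pinned K (\<lambda>n. exp (site_energy \<beta> h n y)) N"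
    "pinned K (\<lambda>n. exp (mixed_energy \<beta> \<beta>' h N n y)) N = pinned K (\<lambda>n. exp (site_energy \<beta>' h n y)) N" for y
    by (auto intro!: pinned_cong simp: mixed_energy_def)
  then have "?E 0 = mean_ln \<beta> h N" "?E N = mean_ln \<beta>' h N" by (simp_all add: mean_ln_def)
  moreover have "?E k \<le> ?E 0" for k
  proof (induction k)
    case (Suc k)
    have "?E (Suc k) \<le> ?E k" using assms False by (intro mixed_energy_step) auto
    with Suc show ?case by linarith
  qed simp
  ultimately show ?thesis by metis
qed simp

end

section \<open>Free energy and critical point\<close>

text \<open>The increments of \<open>ln (L (2 ^ k))\<close> in \<open>k\<close> tend to
  \<open>ln 1 = 0\<close>, hence are bounded. The numerator thus grows at most linearly in
  \<open>k\<close>, the denominator exponentially.\<close>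

lemma slowly_varying_ln_dyadic:
  assumes "slowly_varying L"
  shows "(\<lambda>k. ln (L (2 ^ k)) / 2 ^ k) \<longlonglongrightarrow> 0"
proof -
  let ?x = "\<lambda>k. ln (L (2 ^ k))"
  have pos: "0 < L (2 ^ k)" for k using assms by (simp add: slowly_varying_def)
  have "((\<lambda>x. L (2 * x) / L x) \<longlongrightarrow> 1) at_top" using assms by (auto simp: slowly_varying_def)
  moreover have "filterlim (\<lambda>k::nat. 2 ^ k :: real) at_top sequentially" by real_asymp
  ultimately have "(\<lambda>k. L (2 * 2 ^ k) / L (2 ^ k)) \<longlonglongrightarrow> 1" by (rule filterlim_compose)
  then have "(\<lambda>k. ln (L (2 * 2 ^ k) / L (2 ^ k))) \<longlonglongrightarrow> ln 1" by (rule tendsto_ln) simp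
  moreover have "ln (L (2 * 2 ^ k) / L (2 ^ k)) = ?x (Suc k) - ?x k" for k
    using pos[of k] pos[of "Suc k"] by (simp add: ln_div)
  ultimately have "(\<lambda>k. ?x (Suc k) - ?x k) \<longlonglongrightarrow> 0" by simp
  then have "Bseq (\<lambda>k. ?x (Suc k) - ?x k)" by (intro convergent_imp_Bseq convergentI)
  then obtain B where B: "\<And>k. \<bar>?x (Suc k) - ?x k\<bar> \<le> B" by (auto simp: Bseq_def)
  have x: "\<bar>?x k\<bar> \<le> \<bar>?x 0\<bar> + B * real k" for k
  proof (induction k)
    case (Suc k)
    have "\<bar>?x (Suc k)\<bar> \<le> \<bar>?x k\<bar> + B" using B[of k] by linarith
    with Suc show ?case by (simp add: algebra_simps)
  qed simp
  have lim: "(\<lambda>k. (c + B * real k) / 2 ^ k) \<longlonglongrightarrow> 0" for c by real_asymp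
  show ?thesis
    by (rule Lim_null_comparison[OF always_eventually lim[of "\<bar>?x 0\<bar>"]])
       (use x in \<open>auto simp: abs_divide intro!: divide_right_mono\<close>)
qed

lemma ln_inter_arrival_dyadic:
  assumes "slowly_varying L"
  shows "(\<lambda>k. ln (inter_arrival L \<alpha> (2 ^ k)) / 2 ^ k) \<longlonglongrightarrow> 0"
proof -
  have pos: "0 < L (2 ^ k)" for k using assms by (simp add: slowly_varying_def)
  have "ln (inter_arrival L \<alpha> (2 ^ k)) / 2 ^ k
      = ln (L (2 ^ k)) / 2 ^ k - (1 + \<alpha>) * (real k * ln 2) / 2 ^ k" for k
    using pos[of k] by (simp add: inter_arrival_def ln_div ln_powr ln_realpow diff_divide_distrib)
  moreover have "(\<lambda>k. (1 + \<alpha>) * (real k * ln 2) / 2 ^ k) \<longlonglongrightarrow> 0" by real_asymp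
  ultimately show ?thesis
    using tendsto_diff[OF slowly_varying_ln_dyadic[OF assms]] by fastforce
qed

text \<open>Powers of two suffice here: the free energy dominates every finite-volume value, so its
  nonnegativity can be checked on a subsequence.\<close>

locale subexponential_renewal = disordered_renewal K Q \<omega>
  for K :: "nat \<Rightarrow> real" and Q :: "'b measure" and \<omega> :: "nat \<Rightarrow> 'b \<Rightarrow> real" +
  assumes K_dyadic: "(\<lambda>k. ln (K (2 ^ k)) / 2 ^ k) \<longlonglongrightarrow> 0"
begin

definition fe :: "real \<Rightarrow> real \<Rightarrow> real" where
  "fe \<beta> h = lim (\<lambda>N. mean_ln \<beta> h N / real N)"

definition crit :: "real \<Rightarrow> real" where
  "crit \<beta> = Sup {h. fe \<beta> h = 0}"

lemma fe_limit: "(\<lambda>N. mean_ln \<beta> h N / real N) \<longlonglongrightarrow> fe \<beta> h"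
  and mean_ln_le_fe: "N \<ge> 1 \<Longrightarrow> mean_ln \<beta> h N / real N \<le> fe \<beta> h"
proof -
  obtain l where "(\<lambda>N. mean_ln \<beta> h N / real N) \<longlonglongrightarrow> l" "\<forall>N\<ge>1. mean_ln \<beta> h N / real N \<le> l"
    using fekete_superadditive[OF mean_ln_superadditive mean_ln_le] by blast
  moreover from this(1) have "fe \<beta> h = l" unfolding fe_def by (rule limI)
  ultimately show "(\<lambda>N. mean_ln \<beta> h N / real N) \<longlonglongrightarrow> fe \<beta> h"
    "N \<ge> 1 \<Longrightarrow> mean_ln \<beta> h N / real N \<le> fe \<beta> h" by auto
qed

lemma fe_antimono:
  assumes "0 \<le> \<beta>" "\<beta> \<le> \<beta>'" shows "fe \<beta>' h \<le> fe \<beta> h"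
  using fe_limit fe_limit
  by (rule LIMSEQ_le) (auto intro!: divide_right_mono mean_ln_antimono assms)

text \<open>A single jump to \<open>2 ^ k\<close> already yields a lower bound that tends to
  0.\<close>

lemma fe_nonneg: "0 \<le> fe \<beta> h"
proof (rule LIMSEQ_le_const2)
  let ?c = "h - ln (mgf Q \<omega> \<beta>)"
  have "(\<lambda>k. c / 2 ^ k) \<longlonglongrightarrow> 0" for c :: real by real_asymp
  from tendsto_add[OF this K_dyadic]
  show "(\<lambda>k. ?c / 2 ^ k + ln (K (2 ^ k)) / 2 ^ k) \<longlonglongrightarrow> 0" by simp
  have "?c / 2 ^ k + ln (K (2 ^ k)) / 2 ^ k \<le> fe \<beta> h" for k
  proof -
    have "?c / 2 ^ k + ln (K (2 ^ k)) / 2 ^ k \<le> mean_ln \<beta> h (2 ^ k) / real (2 ^ k)"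
      using mean_ln_ge[of "2 ^ k" h \<beta>]
      by (simp add: add_divide_distrib[symmetric] divide_right_mono)
    also have "\<dots> \<le> fe \<beta> h" by (intro mean_ln_le_fe) simp
    finally show ?thesis .
  qed
  then show "\<exists>N. \<forall>k\<ge>N. ?c / 2 ^ k + ln (K (2 ^ k)) / 2 ^ k \<le> fe \<beta> h" by blast
qed

text \<open>At \<beta> = 0 all weights are at most 1, and monotonicity in \<beta> carries the bound
  over. The set whose supremum is \<open>crit\<close> is therefore nonempty.\<close>

lemma fe_eq_0_of_nonpos:
  assumes "0 \<le> \<beta>" "h \<le> 0" shows "fe \<beta> h = 0"
proof -
  have "fe 0 h \<le> 0"
    using fe_limit by (rule LIMSEQ_le_const2) (auto intro!: divide_nonpos_nonneg mean_ln_zero_nonpos assms)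
  then show ?thesis using fe_antimono[of 0 \<beta> h] fe_nonneg[of \<beta> h] assms by simp
qed

text \<open>Volume 1 gives the bound, so the supremum in \<open>crit\<close> is a genuine
  one.\<close>

lemma fe_zero_bounded:
  assumes "fe \<beta> h = 0" shows "h \<le> ln (mgf Q \<omega> \<beta>) - ln (K 1)"
  using mean_ln_ge[of 1 h \<beta>] mean_ln_le_fe[of 1 \<beta> h] assms by simp

section \<open>The critical point: monotonicity, left-continuity and threshold\<close>

lemma fe_zero_bdd_above: "bdd_above {h. fe \<beta> h = 0}"
  using fe_zero_bounded by (intro bdd_aboveI) auto

lemma le_crit: "fe \<beta> h = 0 \<Longrightarrow> h \<le> crit \<beta>"
  unfolding crit_def by (intro cSup_upper fe_zero_bdd_above) simp

lemma crit_least: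
  "0 \<le> \<beta> \<Longrightarrow> (\<And>h. fe \<beta> h = 0 \<Longrightarrow> h \<le> u) \<Longrightarrow> crit \<beta> \<le> u"
  unfolding crit_def using fe_eq_0_of_nonpos[of \<beta> 0] by (intro cSup_least) auto

lemma crit_mono:
  assumes "0 \<le> \<beta>" "\<beta> \<le> \<beta>'" shows "crit \<beta> \<le> crit \<beta>'"
proof (rule crit_least[OF assms(1)])
  fix h assume "fe \<beta> h = 0"
  then show "h \<le> crit \<beta>'"
    using fe_antimono[OF assms, of h] fe_nonneg[of \<beta>' h] by (intro le_crit) simp
qed

text \<open>The bound comes from convexity of the free energy in \<open>(\<beta>, h - ln M(\<beta>))\<close> along the segment
  from the origin, where it vanishes.\<close>

lemma crit_scale:
  assumes "0 < s" "s \<le> 1" "fe \<beta> h = 0"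
  shows "s * (h - ln (mgf Q \<omega> \<beta>)) + ln (mgf Q \<omega> (s * \<beta>)) \<le> crit (s * \<beta>)" (is "?h \<le> _")
proof (rule le_crit)
  have "fe (s * \<beta>) ?h \<le> s * fe \<beta> h"
    using fe_limit tendsto_mult_left[OF fe_limit]
  proof (rule LIMSEQ_le)
    show "\<exists>N. \<forall>n\<ge>N. mean_ln (s * \<beta>) ?h n / real n \<le> s * (mean_ln \<beta> h n / real n)"
      using mean_ln_scale[OF assms(1,2), of \<beta> h]
      by (metis divide_right_mono of_nat_0_le_iff times_divide_eq_right)
  qed
  then show "fe (s * \<beta>) ?h = 0" using fe_nonneg[of "s * \<beta>" ?h] assms by simp
qed

text \<open>Left-continuity in the form that the threshold argument uses. A zero \<open>h\<close> at
  \<beta> is carried by \<open>crit_scale\<close> to \<open>s * \<beta>\<close>, where the critical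
  value is \<open>u\<close>; then \<open>s\<close> tends to 1.\<close>

lemma crit_left_continuous:
  assumes "0 < \<beta>" "\<And>b. 0 \<le> b \<Longrightarrow> b < \<beta> \<Longrightarrow> crit b = u"
  shows "crit \<beta> \<le> u"
proof (rule crit_least)
  fix h assume h: "fe \<beta> h = 0"
  \<comment> \<open>The shift by 2 keeps the factor strictly between 0 and 1 from
    \<open>n = 0\<close> on.\<close>
  let ?s = "\<lambda>n. 1 - 1 / real (n + 2)"
  let ?f = "\<lambda>s. s * (h - ln (mgf Q \<omega> \<beta>)) + ln (mgf Q \<omega> (s * \<beta>))"
  have "continuous_on UNIV ?f"
    by (intro continuous_intros continuous_on_compose2[OF mgf_continuous]) (auto simp: mgf_pos less_imp_neq[symmetric])
  then have "isCont ?f 1" by (simp add: continuous_on_eq_continuous_at)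
  moreover have "?s \<longlonglongrightarrow> 1" by real_asymp
  ultimately have "(\<lambda>n. ?f (?s n)) \<longlonglongrightarrow> ?f 1" by (rule isCont_tendsto_compose)
  then have "?f 1 \<le> u"
  proof (rule LIMSEQ_le_const2)
    have "?f (?s n) \<le> u" for n
    proof -
      have s: "0 < ?s n" "?s n < 1" by (auto simp: field_simps)
      then have "?f (?s n) \<le> crit (?s n * \<beta>)" using h by (intro crit_scale) auto
      also have "\<dots> = u" using s assms(1) by (intro assms(2)) (auto simp: mult_less_cancel_right1)
      finally show ?thesis .
    qed
    then show "\<exists>N. \<forall>n\<ge>N. ?f (?s n) \<le> u" by blast
  qed
  then show "h \<le> u" by simp
qed (use assms in simp)

text \<open>By monotonicity, \<open>T\<close> is an interval starting at 0, and
  \<open>\<beta>c\<close> is its supremum, possibly infinite. Left-continuity puts a finite positive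
  supremum into \<open>T\<close>.\<close>

lemma crit_threshold:
  "\<exists>\<beta>c::ereal. 0 \<le> \<beta>c \<and> (\<forall>\<beta>::real. 0 \<le> \<beta> \<longrightarrow> (crit 0 = crit \<beta> \<longleftrightarrow> ereal \<beta> \<le> \<beta>c))"
proof -
  define T where "T = {\<beta>. 0 \<le> \<beta> \<and> crit 0 = crit \<beta>}"
  define \<beta>c where "\<beta>c = Sup (ereal ` T)"
  have T0: "0 \<in> T" by (simp add: T_def)
  have below: "\<beta> \<in> T" if "0 \<le> \<beta>" "ereal \<beta> < \<beta>c" for \<beta>
  proof -
    obtain b where "b \<in> T" "\<beta> < b" using \<open>ereal \<beta> < \<beta>c\<close> by (auto simp: \<beta>c_def less_Sup_iff)
    then show ?thesis using crit_mono[of 0 \<beta>] crit_mono[of \<beta> b] that by (simp add: T_def)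
  qed
  have "crit 0 = crit \<beta> \<longleftrightarrow> ereal \<beta> \<le> \<beta>c" if "0 \<le> \<beta>" for \<beta>
  proof
    assume "crit 0 = crit \<beta>"
    then show "ereal \<beta> \<le> \<beta>c" using that unfolding \<beta>c_def by (intro Sup_upper) (simp add: T_def)
  next
    assume *: "ereal \<beta> \<le> \<beta>c"
    show "crit 0 = crit \<beta>"
    proof (cases "\<beta> = 0")
      case False
      have "b \<in> T" if "0 \<le> b" "b < \<beta>" for b
        using that * by (intro below) (auto intro: less_le_trans[of _ "ereal \<beta>"])
      then have "crit \<beta> \<le> crit 0"
        using False \<open>0 \<le> \<beta>\<close> by (intro crit_left_continuous) (auto simp: T_def)
      then show ?thesis using crit_mono[of 0 \<beta>] that by simp
    qed simp
  qed
  moreover have "0 \<le> \<beta>c"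
    unfolding \<beta>c_def using T0 by (intro Sup_upper) (auto simp: zero_ereal_def)
  ultimately show ?thesis by blast
qed

end

theorem proposition6p1:
  fixes P :: "'a measure" and \<tau> :: "nat \<Rightarrow> 'a \<Rightarrow> nat"
    and Q :: "'b measure" and \<omega> :: "nat \<Rightarrow> 'b \<Rightarrow> real"
    and L :: "real \<Rightarrow> real" and \<alpha> :: real
  assumes "pinning_model P \<tau> Q \<omega> L \<alpha>"
  shows "(\<forall>h::real. antimono_on {0..} (\<lambda>\<beta>. free_energy P \<tau> Q \<omega> \<beta> h)) \<and>
         mono_on {0..} (critical_point P \<tau> Q \<omega>) \<and>
         (\<exists>\<beta>c::ereal. 0 \<le> \<beta>c \<and>
           (\<forall>\<beta>::real. 0 \<le> \<beta> \<longrightarrow>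
             (critical_point P \<tau> Q \<omega> 0 = critical_point P \<tau> Q \<omega> \<beta> \<longleftrightarrow> ereal \<beta> \<le> \<beta>c)))"
proof -
  interpret pinning_model P \<tau> Q \<omega> L \<alpha> by fact
  let ?K = "inter_arrival L \<alpha>"
  have L_pos: "0 < L x" if "0 < x" for x
    using L_slowly_varying that by (simp add: slowly_varying_def)
  have K_pos: "0 < ?K n" if "1 \<le> n" for n
    unfolding inter_arrival_def using that by (intro divide_pos_pos L_pos) auto
  have K_sum: "(\<Sum>m<N. ?K (N - m)) \<le> 1" for N
  proof -
    have "(\<Sum>m<N. ?K (N - m)) = (\<Sum>m<N. ?K (Suc m))"
      using sum.nat_diff_reindex[of "\<lambda>m. ?K (Suc m)" N] by (simp add: Suc_diff_Suc)
    also have "\<dots> \<le> (\<Sum>m. ?K (Suc m))"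
      using law_sums K_pos by (intro sum_le_suminf) (auto simp: sums_iff less_imp_le)
    finally show ?thesis using law_sums by (simp add: sums_iff)
  qed
  interpret S: subexponential_renewal ?K Q \<omega>
    using K_pos K_sum ln_inter_arrival_dyadic[OF L_slowly_varying]
    by unfold_locales auto
  \<comment> \<open>The path decomposition integrates out the renewal process for each fixed
    disorder sample; from here on only \<open>K\<close> and the disorder matter.\<close>
  have "partition_fn P \<tau> Q \<omega> \<beta> h N y = pinned ?K (\<lambda>n. exp (S.site_energy \<beta> h n y)) N" for \<beta> h N y
    unfolding partition_fn_def S.site_energy_def by (rule renewal.expectation_exp_contact)
  then have F: "free_energy P \<tau> Q \<omega> = S.fe"
    by (simp add: fun_eq_iff free_energy_def S.fe_def S.mean_ln_def)
  then have "critical_point P \<tau> Q \<omega> = S.crit"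
    by (simp add: fun_eq_iff critical_point_def S.crit_def)
  then show ?thesis
    using F S.fe_antimono S.crit_mono S.crit_threshold by (auto simp: monotone_on_def)
qed

end
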